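(* Let $G$ be a connected graph and let $S_e$ and $S_f$ be equivalence classes of $\mathcal{C}_G$. If $V(S_e)\setminus V(S_f)$, $V(S_f)\setminus V(S_e)$ and $V(S_e)\cap V(S_f)$ are all nonempty, then there is no pair of vertices $u,v\in V(S_e)\cap V(S_f)$ such that $uv\in S_e$ or $uv\in S_f$.
   Context: A quasi-transitive $2$-edge-colouring of a graph $G$ is a map $c: E(G)\to\{R,B\}$ such that for all pairs of edges $xy, yz \in E(G)$ with $c(xy)\neq c(yz)$, we have $xz\in E(G)$. $\mathcal{C}_G$ is the equivalence relation on $E(G)$ with $e\sim f$ iff $c(e)=c(f)$ for every quasi-transitive $2$-edge-colouring $c$ of $G$. For a set of edges $E$, $V(E)$ denotes the set of endpoints of edges in $E$. *)

theory Defs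
  imports Main
begin

text \<open>A simple graph, not necessarily finite, is a vertex set together with a set of
  two-element sets of vertices.\<close>

definition simple_graph :: "'a set \<Rightarrow> 'a set set \<Rightarrow> bool" where
  "simple_graph V E \<longleftrightarrow> (\<forall>e\<in>E. e \<subseteq> V \<and> card e = 2)"

definition connected_graph :: "'a set \<Rightarrow> 'a set set \<Rightarrow> bool" where
  "connected_graph V E \<longleftrightarrow>
     simple_graph V E \<and> (\<forall>u\<in>V. \<forall>v\<in>V. (u, v) \<in> {(x, y). {x, y} \<in> E}\<^sup>*)"

datatype colour = R | B

text \<open>Only the values of the colouring on \<open>E\<close> matter. No case \<open>x = z\<close> arises, since then
  the two edges coincide and have the same colour.\<close>

definition quasi_transitive_colouring :: "'a set set \<Rightarrow> ('a set \<Rightarrow> colour) \<Rightarrow> bool" where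
  "quasi_transitive_colouring E c \<longleftrightarrow>
     (\<forall>x y z. {x, y} \<in> E \<and> {y, z} \<in> E \<and> c {x, y} \<noteq> c {y, z} \<longrightarrow> {x, z} \<in> E)"

definition colour_equiv :: "'a set set \<Rightarrow> ('a set \<times> 'a set) set" where
  "colour_equiv E =
     {(e, f). e \<in> E \<and> f \<in> E \<and> (\<forall>c. quasi_transitive_colouring E c \<longrightarrow> c e = c f)}"

lemma equiv_colour_equiv: "equiv E (colour_equiv E)"
  by (rule equivI) (auto simp: colour_equiv_def refl_on_def sym_def trans_def)

definition endpoints :: "'a set set \<Rightarrow> 'a set" where
  "endpoints F = \<Union>F"

end

theory Submission imports Defs begin

text \<open>A quasi-transitive colouring is only constrained to agree on pairs of edges \<open>xy\<close>, \<open>yz\<close>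
  with \<open>xz\<close> not an edge, so the classes are generated by these pairs. Consequently
  the vertex set \<open>M\<close> of a class is a module: a vertex outside \<open>M\<close> is adjacent to all of \<open>M\<close> or
  to none of it. But then a generating pair cannot have one edge inside \<open>M\<close> and the other
  leaving \<open>M\<close>, so a class with an edge inside \<open>M\<close> has all its endpoints in \<open>M\<close>.\<close>

lemma colour_class_step:
  assumes S: "S \<in> E // colour_equiv E"
    and "{x, y} \<in> S" and yz: "{y, z} \<in> E" and xz: "{x, z} \<notin> E"
  shows "{y, z} \<in> S"
proof -
  have "{x, y} \<in> E"
    using S \<open>{x, y} \<in> S\<close> in_quotient_imp_subset[OF equiv_colour_equiv] by blast
  then have "({x, y}, {y, z}) \<in> colour_equiv E"
    using yz xz unfolding colour_equiv_def quasi_transitive_colouring_def by blast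
  then show ?thesis
    using in_quotient_imp_closed[OF equiv_colour_equiv S \<open>{x, y} \<in> S\<close>] by blast
qed

text \<open>Induction along a class: were some \<open>f\<close> of \<open>S\<close> outside
  \<open>P\<close>, the colouring with exactly \<open>S \<inter> P\<close> in \<open>R\<close> would
  be quasi-transitive yet separate \<open>e\<close> from \<open>f\<close>.\<close>

lemma colour_class_subset_closed:
  assumes S: "S \<in> E // colour_equiv E"
    and e: "e \<in> S" "e \<in> P"
    and closed: "\<And>x y z. {x, y} \<in> P \<Longrightarrow> {x, y} \<in> S \<Longrightarrow> {y, z} \<in> S \<Longrightarrow> {x, z} \<notin> E \<Longrightarrow> {y, z} \<in> P"
  shows "S \<subseteq> P"
proof
  fix f assume f: "f \<in> S"
  define c where "c g = (if g \<in> S \<inter> P then R else B)" for g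
  have step: "{y, z} \<in> S \<inter> P"
    if "{x, y} \<in> S \<inter> P" "{y, z} \<in> E" "{x, z} \<notin> E" for x y z
    using that colour_class_step[OF S, of x y z] closed[of x y z] by blast
  have "quasi_transitive_colouring E c"
    unfolding quasi_transitive_colouring_def
  proof (intro allI impI, elim conjE)
    fix x y z assume *: "{x, y} \<in> E" "{y, z} \<in> E" "c {x, y} \<noteq> c {y, z}"
    show "{x, z} \<in> E"
    proof (rule ccontr)
      assume "{x, z} \<notin> E"
      \<comment> \<open>Closure is directed, so \<open>step\<close> is applied along
        \<open>x\<close>, \<open>y\<close>, \<open>z\<close> and along the reversed path.\<close>
      then have "{x, y} \<in> S \<inter> P \<longleftrightarrow> {y, z} \<in> S \<inter> P"
        using step[of x y z] step[of z y x] *(1,2)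
        by (metis insert_commute)
      then show False using *(3) by (simp add: c_def)
    qed
  qed
  moreover have "(e, f) \<in> colour_equiv E"
    using in_quotient_imp_in_rel[OF equiv_colour_equiv S] e f by blast
  ultimately have "c e = c f" by (auto simp: colour_equiv_def)
  then show "f \<in> P" using e by (auto simp: c_def split: if_splits)
qed

lemma endpoints_colour_class_module:
  assumes G: "simple_graph V E" and S: "S \<in> E // colour_equiv E"
    and w: "w \<notin> endpoints S" and a: "a \<in> endpoints S" "{w, a} \<in> E"
    and b: "b \<in> endpoints S"
  shows "{w, b} \<in> E"
proof -
  \<comment> \<open>Otherwise \<open>{y, x}\<close> and \<open>{x, w}\<close> form a generating
    pair, making \<open>w\<close> an endpoint of \<open>S\<close>.\<close>
  have propagate: "{w, y} \<in> E" if "{x, y} \<in> S" "{w, x} \<in> E" for x y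
  proof (rule ccontr)
    assume "{w, y} \<notin> E"
    then have "{x, w} \<in> S"
      using colour_class_step[OF S, of y x w] that by (simp add: insert_commute)
    then show False using w by (auto simp: endpoints_def)
  qed
  obtain e where e: "e \<in> S" "a \<in> e" using a by (auto simp: endpoints_def)
  then have "e \<in> E" using S in_quotient_imp_subset[OF equiv_colour_equiv] by blast
  then have "card e = 2" using G by (auto simp: simple_graph_def)
  then obtain d where "e = {a, d}" using e(2) by (auto simp: card_2_iff)
  \<comment> \<open>Induction over \<open>S\<close>, starting at an edge through \<open>a\<close>;
    the invariant is that \<open>w\<close> is adjacent to both ends.\<close>
  then have "e \<in> {e. \<forall>x\<in>e. {w, x} \<in> E}" using propagate[of a d] e(1) a(2) by auto
  then have "S \<subseteq> {e. \<forall>x\<in>e. {w, x} \<in> E}"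
  proof (rule colour_class_subset_closed[OF S e(1)])
    fix x y z
    assume "{x, y} \<in> {e. \<forall>x\<in>e. {w, x} \<in> E}" "{y, z} \<in> S"
    then show "{y, z} \<in> {e. \<forall>x\<in>e. {w, x} \<in> E}" using propagate[of y z] by simp
  qed
  then show ?thesis using b by (auto simp: endpoints_def)
qed

lemma colour_class_within_endpoints:
  assumes G: "simple_graph V E"
    and S: "S \<in> E // colour_equiv E" and T: "T \<in> E // colour_equiv E"
    and uv: "{u, v} \<in> S" "u \<in> endpoints T" "v \<in> endpoints T"
  shows "endpoints S \<subseteq> endpoints T"
proof -
  have "S \<subseteq> {e. e \<subseteq> endpoints T}"
  proof (rule colour_class_subset_closed[OF S uv(1)])
    show "{u, v} \<in> {e. e \<subseteq> endpoints T}" using uv by simp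
  next
    fix x y z
    assume *: "{x, y} \<in> {e. e \<subseteq> endpoints T}" "{y, z} \<in> S" "{x, z} \<notin> E"
    have "{y, z} \<in> E" using *(2) S in_quotient_imp_subset[OF equiv_colour_equiv] by blast
    \<comment> \<open>If \<open>z\<close> lay outside the module \<open>endpoints T\<close>, its
      adjacency to \<open>y\<close> would force adjacency to \<open>x\<close>.\<close>
    then have "z \<in> endpoints T"
      using endpoints_colour_class_module[OF G T, of z y x] *(1,3)
      by (metis insert_commute insert_subset mem_Collect_eq)
    then show "{y, z} \<in> {e. e \<subseteq> endpoints T}" using *(1) by simp
  qed
  then show ?thesis by (auto simp: endpoints_def)
qed

theorem theorem22:
  fixes V :: "'a set" and E S\<^sub>e S\<^sub>f :: "'a set set"
  assumes "connected_graph V E"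
    and "S\<^sub>e \<in> E // colour_equiv E"
    and "S\<^sub>f \<in> E // colour_equiv E"
    and "endpoints S\<^sub>e - endpoints S\<^sub>f \<noteq> {}"
    and "endpoints S\<^sub>f - endpoints S\<^sub>e \<noteq> {}"
    and "endpoints S\<^sub>e \<inter> endpoints S\<^sub>f \<noteq> {}"
  shows "\<not> (\<exists>u\<in>endpoints S\<^sub>e \<inter> endpoints S\<^sub>f. \<exists>v\<in>endpoints S\<^sub>e \<inter> endpoints S\<^sub>f.
            {u, v} \<in> S\<^sub>e \<or> {u, v} \<in> S\<^sub>f)"
proof -
  have "simple_graph V E" using assms(1) by (simp add: connected_graph_def)
  note within = colour_class_within_endpoints[OF this]
  \<comment> \<open>An edge of one class with both ends in the intersection would put all endpoints
    of that class inside the other's, emptying one of the differences.\<close>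
  show ?thesis
    using within[OF assms(2,3)] within[OF assms(3,2)] assms(4,5) by blast
qed

end
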